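(* Let $n,m\ge 1$ and $1\le k\le n$ be integers, let $\lambda>0$ and $L>0$, and let $u:[0,1]^{n\times m}\to\mathbb{R}^n$ be a $\lambda$-Lipschitz utility function. Then the Clipped Linear Lottery with utility $u$, Lipschitz constant $\lambda$, smoothness parameter $L$ and budget $k$ is $L$-smooth; that is, its marginal selection probabilities $p:[0,1]^{n\times m}\to[0,1]^n$ satisfy $$\|p(X)-p(X')\|_1\le L\,\|X-X'\|_{1,1}\qquad\text{for all }X,X'\in[0,1]^{n\times m}.$$
   Context: $X\in[0,1]^{n\times m}$ is a review matrix ($n$ candidates, $m$ reviews each) and $\|A\|_{1,1}=\sum_{i,j}|A_{i,j}|$. A utility function $u:[0,1]^{n\times m}\to\mathbb{R}^n$ is $\lambda$-Lipschitz if $\|u(X)-u(X')\|_1\le\lambda\|X-X'\|_{1,1}$ for all $X,X'\in[0,1]^{n\times m}$. A randomized selection rule maps each $X$ to a probability distribution on the size-$k$ subsets of $[n]=\{1,\dots,n\}$; its marginals are $p_i(X)=\Pr_S[i\in S]$, where $S$ is drawn from that distribution. It is $L$-smooth if its marginals satisfy the displayed inequality. Clipped Linear Lottery: let $\mathrm{clip}_{[0,1]}(x)=\min\{1,\max\{0,x\}\}$ and slope $a=L/(2\lambda)$. Given $X$, let $b\in\mathbb{R}$ be an intercept with $\sum_{i=1}^n\mathrm{clip}_{[0,1]}(a\,u_i(X)+b)=k$ (such $b$ exists and the resulting vector of clipped values does not depend on the choice of $b$). The rule has marginals $p_i(X)=\mathrm{clip}_{[0,1]}(a\,u_i(X)+b)$,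 and the selected set is sampled from any distribution on size-$k$ subsets having these marginals. *)

theory Defs
  imports "HOL-Probability.Probability"
begin

(* Candidates are the elements of the finite type 'n and review slots those of 'm, so that
   n = CARD('n) and m = CARD('m); row X $ i holds the reviews of candidate i. *)

definition review_matrices :: "(real ^ 'm ^ 'n) set" where
  "review_matrices = {X. \<forall>i j. 0 \<le> X $ i $ j \<and> X $ i $ j \<le> 1}"

(* The metric that real ^ 'n carries in the library is the Euclidean one, which is why the
   Lipschitz and smoothness conditions below do not use lipschitz_on. *)

definition l1_norm :: "real ^ 'n \<Rightarrow> real" where
  "l1_norm v = (\<Sum>i\<in>UNIV. \<bar>v $ i\<bar>)"

definition l11_norm :: "real ^ 'm ^ 'n \<Rightarrow> real" where
  "l11_norm A = (\<Sum>i\<in>UNIV. \<Sum>j\<in>UNIV. \<bar>A $ i $ j\<bar>)"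

definition lipschitz_utility :: "real \<Rightarrow> (real ^ 'm ^ 'n \<Rightarrow> real ^ 'n) \<Rightarrow> bool" where
  "lipschitz_utility lam u \<longleftrightarrow>
     (\<forall>X\<in>review_matrices. \<forall>X'\<in>review_matrices.
        l1_norm (u X - u X') \<le> lam * l11_norm (X - X'))"

definition selection_rule :: "nat \<Rightarrow> (real ^ 'm ^ 'n \<Rightarrow> 'n set pmf) \<Rightarrow> bool" where
  "selection_rule k R \<longleftrightarrow> (\<forall>X\<in>review_matrices. set_pmf (R X) \<subseteq> {S. card S = k})"

definition marginals :: "(real ^ 'm ^ 'n \<Rightarrow> 'n set pmf) \<Rightarrow> real ^ 'm ^ 'n \<Rightarrow> real ^ 'n" where
  "marginals R X = (\<chi> i. measure_pmf.prob (R X) {S. i \<in> S})"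

definition smooth_rule :: "real \<Rightarrow> (real ^ 'm ^ 'n \<Rightarrow> 'n set pmf) \<Rightarrow> bool" where
  "smooth_rule L R \<longleftrightarrow>
     (\<forall>X\<in>review_matrices. \<forall>X'\<in>review_matrices.
        l1_norm (marginals R X - marginals R X') \<le> L * l11_norm (X - X'))"

definition clip01 :: "real \<Rightarrow> real" where
  "clip01 x = min 1 (max 0 x)"

definition clipped_line :: "real \<Rightarrow> real ^ 'n \<Rightarrow> real \<Rightarrow> real ^ 'n" where
  "clipped_line a v b = (\<chi> i. clip01 (a * v $ i + b))"

definition is_intercept :: "real \<Rightarrow> nat \<Rightarrow> real ^ 'n \<Rightarrow> real \<Rightarrow> bool" where
  "is_intercept a k v b \<longleftrightarrow> (\<Sum>i\<in>UNIV. clipped_line a v b $ i) = real k"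

(* A predicate rather than a function: any sampling scheme with the prescribed marginals
   counts as a Clipped Linear Lottery. By clipped_line_unique the choice of the intercept
   does not matter, and by intercept_exists there always is one. *)

definition clipped_linear_lottery ::
  "(real ^ 'm ^ 'n \<Rightarrow> real ^ 'n) \<Rightarrow> real \<Rightarrow> real \<Rightarrow> nat \<Rightarrow> (real ^ 'm ^ 'n \<Rightarrow> 'n set pmf) \<Rightarrow> bool"
  where
  "clipped_linear_lottery u lam L k R \<longleftrightarrow>
     selection_rule k R \<and>
     (\<forall>X\<in>review_matrices. \<exists>b. is_intercept (L / (2 * lam)) k (u X) b \<and>
        marginals R X = clipped_line (L / (2 * lam)) (u X) b)"

lemma clipped_line_mono: "b \<le> c \<Longrightarrow> clipped_line a v b $ i \<le> clipped_line a v c $ i"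
  unfolding clipped_line_def clip01_def vec_lambda_beta by linarith

lemma clipped_line_unique:
  fixes v :: "real ^ 'n"
  assumes "is_intercept a k v b" "is_intercept a k v c"
  shows "clipped_line a v b = clipped_line a v c"
proof -
  have *: "clipped_line a v b' = clipped_line a v c'"
    if "b' \<le> c'" "is_intercept a k v b'" "is_intercept a k v c'" for b' c'
  proof -
    have eq: "(\<Sum>i\<in>UNIV. clipped_line a v b' $ i) = (\<Sum>i\<in>UNIV. clipped_line a v c' $ i)"
      using that(2,3) by (simp add: is_intercept_def)
    have "clipped_line a v b' $ i = clipped_line a v c' $ i" for i
      by (rule sum_mono_inv[OF eq]) (auto intro: clipped_line_mono that(1))
    then show ?thesis by (simp add: vec_eq_iff)
  qed
  show ?thesis
    using linear[of b c] *[OF _ assms] *[OF _ assms(2,1)] by metis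
qed

lemma intercept_exists:
  fixes v :: "real ^ 'n"
  assumes "k \<le> CARD('n)"
  shows "\<exists>b. is_intercept a k v b"
proof -
  define f where "f = (\<lambda>b. \<Sum>i\<in>UNIV. clipped_line a v b $ i)"
  define M where "M = (\<Sum>i\<in>UNIV. \<bar>a * v $ i\<bar>) + 1"
  have bound: "\<bar>a * v $ i\<bar> \<le> M - 1" for i
  proof -
    have "\<bar>a * v $ i\<bar> \<le> (\<Sum>i\<in>UNIV. \<bar>a * v $ i\<bar>)"
      by (rule member_le_sum) auto
    then show ?thesis unfolding M_def by linarith
  qed
  have "clipped_line a v (- M) $ i = 0" for i
    using bound[of i] unfolding clipped_line_def clip01_def vec_lambda_beta by linarith
  then have lo: "f (- M) \<le> real k"
    by (simp add: f_def)
  have "clipped_line a v M $ i = 1" for i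
    using bound[of i] unfolding clipped_line_def clip01_def vec_lambda_beta by linarith
  then have hi: "real k \<le> f M"
    using assms by (simp add: f_def)
  have "continuous_on {- M..M} f"
    unfolding f_def clipped_line_def clip01_def by (auto intro!: continuous_intros)
  moreover have "- M \<le> M"
    using abs_ge_zero[of "a * v $ undefined"] bound[of undefined] by linarith
  ultimately obtain b where "f b = real k"
    using IVT'[of f "- M" "real k" M] lo hi by blast
  then show ?thesis
    by (auto simp: is_intercept_def f_def)
qed

end

(* For intercepts b <= c the larger intercept can only raise entries, so an entry drops from
   clip (a v_i + b) to clip (a w_i + c) by at most |a| |v_i - w_i|. As both vectors sum to k,
   their l1 distance is twice the total drop, whence the factor 2 in the slope L / (2 lam). *)

theory Submission
  imports Defs
begin

text \<open>\<open>clip01\<close> is nondecreasing and 1-Lipschitz: lowering \<open>c\<close> to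
  \<open>b\<close> only enlarges the difference, and at equal intercepts the Lipschitz bound
  applies. No such bound holds for rises, which also depend on \<open>c - b\<close>.\<close>

lemma clipped_line_drop_le:
  assumes "b \<le> c"
  shows "clipped_line a v b $ i - clipped_line a w c $ i \<le> \<bar>a\<bar> * \<bar>(v - w) $ i\<bar>"
proof -
  have "\<bar>a * v $ i - a * w $ i\<bar> = \<bar>a\<bar> * \<bar>(v - w) $ i\<bar>"
    by (simp add: abs_mult flip: right_diff_distrib)
  then show ?thesis
    using assms unfolding clipped_line_def clip01_def vec_lambda_beta by linarith
qed

lemma l1_norm_diff_commute: "l1_norm (v - w) = l1_norm (w - v)"
  by (simp add: l1_norm_def abs_minus_commute)

lemma clipped_line_l1_le:
  assumes "is_intercept a k v b" and "is_intercept a k w c"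
  shows "l1_norm (clipped_line a v b - clipped_line a w c) \<le> 2 * \<bar>a\<bar> * l1_norm (v - w)"
  using assms
\<comment> \<open>The vectors stay arbitrary because exchanging the intercepts must exchange
  \<open>v\<close> and \<open>w\<close> too.\<close>
proof (induction b c arbitrary: v w rule: linorder_wlog)
  case (le b c)
  let ?p = "clipped_line a v b" and ?q = "clipped_line a w c"
  \<comment> \<open>Entrywise, \<open>\<bar>x\<bar> = 2 * max x 0 - x\<close>, where the drop
    \<open>max x 0\<close> is bounded by the previous lemma. The linear term is kept since its sum
    is \<open>k - k = 0\<close>.\<close>
  have "l1_norm (?p - ?q) \<le> (\<Sum>i\<in>UNIV. 2 * (\<bar>a\<bar> * \<bar>(v - w) $ i\<bar>) - (?p $ i - ?q $ i))"
    unfolding l1_norm_def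
  proof (rule sum_mono)
    fix i
    have "0 \<le> \<bar>a\<bar> * \<bar>(v - w) $ i\<bar>"
      by simp
    then show "\<bar>(?p - ?q) $ i\<bar> \<le> 2 * (\<bar>a\<bar> * \<bar>(v - w) $ i\<bar>) - (?p $ i - ?q $ i)"
      using clipped_line_drop_le[OF le(1), of a v i w]
      unfolding vector_minus_component[of ?p] by linarith
  qed
  also have "\<dots> = 2 * \<bar>a\<bar> * l1_norm (v - w)"
    using le(2,3)
    by (simp add: sum_subtractf is_intercept_def l1_norm_def mult.assoc flip: sum_distrib_left)
  finally show ?case .
next
  case (sym b c)
  then show ?case
    by (metis l1_norm_diff_commute)
qed

theorem theorem1:
  fixes u :: "real ^ 'm ^ 'n \<Rightarrow> real ^ 'n"
    and R :: "real ^ 'm ^ 'n \<Rightarrow> 'n set pmf"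
    and k :: nat and lam L :: real
  assumes "1 \<le> k" and "k \<le> CARD('n)"
    and "lam > 0" and "L > 0"
    and "lipschitz_utility lam u"
    and "clipped_linear_lottery u lam L k R"
  shows "smooth_rule L R"
  unfolding smooth_rule_def
proof (intro ballI)
  fix X X' :: "real ^ 'm ^ 'n"
  assume X: "X \<in> review_matrices" "X' \<in> review_matrices"
  let ?a = "L / (2 * lam)"
  obtain b where b: "is_intercept ?a k (u X) b" "marginals R X = clipped_line ?a (u X) b"
    using assms(6) X(1) unfolding clipped_linear_lottery_def by blast
  obtain c where c: "is_intercept ?a k (u X') c" "marginals R X' = clipped_line ?a (u X') c"
    using assms(6) X(2) unfolding clipped_linear_lottery_def by blast
  have "l1_norm (marginals R X - marginals R X') \<le> 2 * \<bar>?a\<bar> * l1_norm (u X - u X')"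
    unfolding b(2) c(2) using b(1) c(1) by (rule clipped_line_l1_le)
  also have "\<dots> \<le> 2 * \<bar>?a\<bar> * (lam * l11_norm (X - X'))"
    using assms(5) X unfolding lipschitz_utility_def by (intro mult_left_mono) auto
  \<comment> \<open>The slope is positive and solves \<open>2 * ?a * lam = L\<close>.\<close>
  also have "\<dots> = L * l11_norm (X - X')"
    using assms(3,4) by simp
  finally show "l1_norm (marginals R X - marginals R X') \<le> L * l11_norm (X - X')" .
qed

end
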